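(* Let $n\geq 8$ be an integer. The graph $J_{\{2\}}(n,4)$, whose vertices are the $4$-element subsets of $\{1,\dots,n\}$ with two vertices adjacent if and only if they intersect in exactly $2$ elements, is not determined by its spectrum; that is, there exists a graph that is cospectral with $J_{\{2\}}(n,4)$ but not isomorphic to it.
   Context: All graphs are simple and loopless. The spectrum of a graph is the multiset of eigenvalues of its adjacency matrix. Two graphs are cospectral if they have the same spectrum. A graph is determined by its spectrum if every graph cospectral with it is isomorphic to it. *)

theory Defs
  imports
    "Graph_Theory.Graph_Theory"
    "Jordan_Normal_Form.Char_Poly"
begin

text \<open>
  Finite simple graphs are the graphs of the locale \<^locale>\<open>pair_graph\<close>: finite vertex set,
  irreflexive symmetric set of ordered pairs as adjacency relation. Isomorphism is
  \<^const>\<open>digraph_iso\<close> (see \<open>digraph_iso_pair_iff\<close> below for its meaning on these graphs).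
\<close>

definition adjacency_mat :: "'a pair_pre_digraph \<Rightarrow> 'a list \<Rightarrow> real mat" where
  "adjacency_mat G vs =
     mat (length vs) (length vs) (\<lambda>(i, j). if (vs ! i, vs ! j) \<in> parcs G then 1 else 0)"

text \<open>
  The spectrum is a multiset, so it is not the set-valued \<open>spectrum\<close> of the matrix library.
  An eigenvalue is counted with its multiplicity as a root of the characteristic polynomial; for
  the real symmetric matrix of a graph this is also the dimension of its eigenspace, and no
  eigenvalue is lost by working over the reals. The enumeration of the vertices is immaterial
  (\<open>graph_spectrum_eq\<close>).
\<close>

definition graph_spectrum :: "'a pair_pre_digraph \<Rightarrow> real multiset" where
  "graph_spectrum G =
     proots (char_poly (adjacency_mat G (SOME vs. distinct vs \<and> set vs = pverts G)))"

definition cospectral :: "'a pair_pre_digraph \<Rightarrow> 'b pair_pre_digraph \<Rightarrow> bool" where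
  "cospectral G H \<longleftrightarrow> graph_spectrum G = graph_spectrum H"

text \<open>
  Quantification over all finite simple graphs is quantification over those whose vertices are
  natural numbers; \<open>determined_by_spectrumD\<close> shows that nothing is lost.
\<close>

definition determined_by_spectrum :: "'a pair_pre_digraph \<Rightarrow> bool" where
  "determined_by_spectrum G \<longleftrightarrow>
     (\<forall>H :: nat pair_pre_digraph. pair_graph H \<and> cospectral G H \<longrightarrow> digraph_iso H G)"

text \<open>
  The graph \<open>J\<^sub>S(n,k)\<close>; it has no loops as long as \<open>k \<notin> S\<close>.
\<close>

definition johnson_graph :: "nat set \<Rightarrow> nat \<Rightarrow> nat \<Rightarrow> nat set pair_pre_digraph" where
  "johnson_graph S n k =
     (let V = {A. A \<subseteq> {1..n} \<and> card A = k}
      in \<lparr>pverts = V, parcs = {(A, B). A \<in> V \<and> B \<in> V \<and> card (A \<inter> B) \<in> S}\<rparr>)"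

lemma pair_graph_johnson_graph:
  assumes "k \<notin> S"
  shows "pair_graph (johnson_graph S n k)"
proof -
  let ?V = "{A. A \<subseteq> {1..n} \<and> card A = k}"
  have fin: "finite ?V"
    by (rule finite_subset[of _ "Pow {1..n}"]) auto
  have "parcs (johnson_graph S n k) \<subseteq> ?V \<times> ?V"
    by (auto simp: johnson_graph_def Let_def)
  then have "finite (parcs (johnson_graph S n k))"
    by (rule finite_subset) (use fin in blast)
  moreover have "finite (pverts (johnson_graph S n k))"
    using fin by (simp add: johnson_graph_def Let_def)
  moreover have "symmetric (johnson_graph S n k)"
    unfolding symmetric_def with_proj_simps
    by (rule symI) (simp add: johnson_graph_def Let_def Int_commute)
  moreover have "fst e \<noteq> snd e" if "e \<in> parcs (johnson_graph S n k)" for e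
  proof
    assume "fst e = snd e"
    moreover have "card (fst e) = k" "card (fst e \<inter> snd e) \<in> S"
      using that by (simp_all add: johnson_graph_def Let_def case_prod_beta)
    ultimately show False
      using assms by simp
  qed
  moreover have "fst e \<in> pverts (johnson_graph S n k)" "snd e \<in> pverts (johnson_graph S n k)"
    if "e \<in> parcs (johnson_graph S n k)" for e
    using that by (auto simp: johnson_graph_def Let_def)
  ultimately show ?thesis
    by unfold_locales
qed

lemma det_permute_both:
  fixes A :: "'a :: comm_ring_1 mat"
  assumes A: "A \<in> carrier_mat n n" and p: "p permutes {0..<n}"
  shows "det (mat n n (\<lambda>(i, j). A $$ (p i, p j))) = det A"
proof -
  define B where "B = mat n n (\<lambda>(i, j). A $$ (p i, j))"
  have B: "B \<in> carrier_mat n n" by (simp add: B_def)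
  have pn: "p i < n" if "i < n" for i
    using permutes_in_image[OF p, of i] that by simp
  let ?C = "mat n n (\<lambda>(i, j). A $$ (p i, p j))"
  have "det ?C = det (transpose_mat ?C)"
    by (rule det_transpose[of _ n, symmetric]) simp
  also have "transpose_mat ?C = mat n n (\<lambda>(i, j). transpose_mat B $$ (p i, j))"
    by (rule eq_matI) (auto simp: B_def pn)
  also have "det \<dots> = signof p * det (transpose_mat B)"
    using B p by (intro det_permute_rows) auto
  also have "det (transpose_mat B) = det B"
    using B by (rule det_transpose)
  also have "det B = signof p * det A"
    unfolding B_def using A p by (rule det_permute_rows)
  also have "signof p * (signof p * det A) = det A"
    by (simp add: sign_def)
  finally show ?thesis .
qed

lemma char_poly_adjacency_mat_cong:
  assumes "distinct vs" "distinct ws" "set vs = set ws"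
  shows "char_poly (adjacency_mat G vs) = char_poly (adjacency_mat G ws)"
proof -
  define n where "n = length ws"
  have "mset vs = mset ws"
    using assms by (simp add: set_eq_iff_mset_eq_distinct)
  then obtain p where p: "p permutes {..<length ws}" "permute_list p ws = vs"
    by (rule mset_eq_permutation)
  have p': "p permutes {0..<n}"
    using p(1) by (simp add: n_def atLeast0LessThan)
  have pn: "p i < n" if "i < n" for i
    using permutes_in_image[OF p', of i] that by simp
  have inj: "p i = p j \<longleftrightarrow> i = j" for i j
    using permutes_inj[OF p'] by (auto dest: injD)
  have len: "length vs = n"
    using p(2) by (auto simp: n_def)
  have nth: "vs ! i = ws ! p i" if "i < n" for i
    using that p by (auto simp: n_def permute_list_nth)
  let ?A = "char_poly_matrix (adjacency_mat G ws)"
  have A: "?A \<in> carrier_mat n n"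
    by (rule char_poly_matrix_closed) (simp add: adjacency_mat_def n_def)
  have "char_poly_matrix (adjacency_mat G vs) = mat n n (\<lambda>(i, j). ?A $$ (p i, p j))"
    by (rule eq_matI)
      (auto simp: char_poly_matrix_def adjacency_mat_def len nth pn inj n_def[symmetric])
  then show ?thesis
    unfolding char_poly_def using det_permute_both[OF A p'] by simp
qed

lemma graph_spectrum_eq:
  assumes "distinct vs" "set vs = pverts G"
  shows "graph_spectrum G = proots (char_poly (adjacency_mat G vs))"
proof -
  let ?P = "\<lambda>vs. distinct vs \<and> set vs = pverts G"
  have "?P (SOME vs. ?P vs)"
    by (rule someI[of ?P vs]) (use assms in simp)
  then show ?thesis
    unfolding graph_spectrum_def
    using assms char_poly_adjacency_mat_cong[of "SOME vs. ?P vs" vs G] by simp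
qed

lemma set_mset_graph_spectrum:
  assumes "distinct vs" "set vs = pverts G"
  shows "set_mset (graph_spectrum G) = {x. eigenvalue (adjacency_mat G vs) x}"
proof -
  have A: "adjacency_mat G vs \<in> carrier_mat (length vs) (length vs)"
    by (simp add: adjacency_mat_def)
  have "char_poly (adjacency_mat G vs) \<noteq> 0"
    using degree_monic_char_poly[OF A] by auto
  then show ?thesis
    by (simp add: graph_spectrum_eq[OF assms] eigenvalue_root_char_poly[OF A])
qed

lemma digraph_iso_pair_iff:
  assumes "pair_wf_digraph G" "pair_wf_digraph H"
  shows "digraph_iso G H \<longleftrightarrow>
    (\<exists>f. bij_betw f (pverts G) (pverts H) \<and>
       (\<forall>u\<in>pverts G. \<forall>v\<in>pverts G. (u, v) \<in> parcs G \<longleftrightarrow> (f u, f v) \<in> parcs H))"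
    (is "?L \<longleftrightarrow> ?R")
proof
  interpret G: pair_wf_digraph G by fact
  interpret H: pair_wf_digraph H by fact
  {
    assume ?L
    then obtain h where h: "pre_digraph.digraph_isomorphism (with_proj G) h"
      and H: "with_proj H = app_iso h (with_proj G)"
      unfolding digraph_iso_def by blast
    let ?f = "iso_verts h"
    have V: "pverts H = ?f ` pverts G"
      using arg_cong[OF H, of verts] by simp
    have E: "parcs H = iso_arcs h ` parcs G"
      using arg_cong[OF H, of arcs] by simp
    have t: "iso_tail h = fst" and hd: "iso_head h = snd"
      using arg_cong[OF H, of tail] arg_cong[OF H, of head] by simp_all
    have inj: "inj_on ?f (pverts G)"
      using h by (simp add: pre_digraph.digraph_isomorphism_def)
    have arc: "iso_arcs h a = (?f (fst a), ?f (snd a))" if "a \<in> parcs G" for a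
      using h that
      by (auto simp: pre_digraph.digraph_isomorphism_def t hd intro!: prod_eqI)
    have "(u, v) \<in> parcs G \<longleftrightarrow> (?f u, ?f v) \<in> parcs H"
      if "u \<in> pverts G" "v \<in> pverts G" for u v
    proof
      assume "(u, v) \<in> parcs G"
      then show "(?f u, ?f v) \<in> parcs H"
        unfolding E using arc[of "(u, v)"] by force
    next
      assume "(?f u, ?f v) \<in> parcs H"
      then obtain a where a: "a \<in> parcs G" "iso_arcs h a = (?f u, ?f v)"
        unfolding E by force
      then have "fst a = u" "snd a = v"
        using arc[OF a(1)] that inj G.arc_fst_in_verts G.arc_snd_in_verts
        by (auto dest: inj_onD)
      then show "(u, v) \<in> parcs G" using a(1) by auto
    qed
    then show ?R
      using inj V by (intro exI[of _ ?f]) (auto simp: bij_betw_def)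
  next
    assume ?R
    then obtain f where f: "inj_on f (pverts G)" "f ` pverts G = pverts H"
      and adj: "\<And>u v. u \<in> pverts G \<Longrightarrow> v \<in> pverts G \<Longrightarrow>
        (u, v) \<in> parcs G \<longleftrightarrow> (f u, f v) \<in> parcs H"
      by (auto simp: bij_betw_def)
    let ?h = "\<lparr>iso_verts = f, iso_arcs = map_prod f f, iso_head = snd, iso_tail = fst\<rparr>"
    have "parcs G \<subseteq> pverts G \<times> pverts G"
      by (auto dest: G.in_arcsD1 G.in_arcsD2)
    then have "inj_on (map_prod f f) (parcs G)"
      by (rule inj_on_subset[OF map_prod_inj_on[OF f(1) f(1)]])
    then have 1: "pre_digraph.digraph_isomorphism (with_proj G) ?h"
      using f(1) by (auto simp: pre_digraph.digraph_isomorphism_def intro: G.wf_digraph)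
    have "parcs H = map_prod f f ` parcs G"
    proof (intro equalityI subsetI)
      fix a assume a: "a \<in> parcs H"
      obtain x y where xy: "a = (x, y)" by force
      have "x \<in> f ` pverts G" "y \<in> f ` pverts G"
        using a xy f(2) by (auto dest: H.in_arcsD1 H.in_arcsD2)
      then obtain u v where "x = f u" "y = f v" "u \<in> pverts G" "v \<in> pverts G"
        by blast
      then show "a \<in> map_prod f f ` parcs G"
        using adj[of u v] a xy by (intro image_eqI[of _ _ "(u, v)"]) auto
    next
      fix a assume "a \<in> map_prod f f ` parcs G"
      then show "a \<in> parcs H"
        using adj by (auto dest: G.in_arcsD1 G.in_arcsD2)
    qed
    then have "with_proj H = app_iso ?h (with_proj G)"
      using f(2) by (simp add: with_proj_def app_iso_def)
    with 1 show ?L unfolding digraph_iso_def by blast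
  }
qed

lemma determined_by_spectrumD:
  fixes H :: "'b pair_pre_digraph"
  assumes G: "determined_by_spectrum G" and H: "pair_graph H" and "cospectral G H"
  shows "digraph_iso H G"
proof -
  interpret H: pair_graph H by fact
  have fin: "finite (pverts H)" by (rule H.pair_finite_verts)
  obtain f :: "'b \<Rightarrow> nat" where f: "inj_on f (pverts H)"
    using finite_imp_inj_to_nat_seg[OF fin] by blast
  define K where "K = \<lparr>pverts = f ` pverts H, parcs = map_prod f f ` parcs H\<rparr>"
  have adj: "(u, v) \<in> parcs H \<longleftrightarrow> (f u, f v) \<in> parcs K"
    if "u \<in> pverts H" "v \<in> pverts H" for u v
    using that f by (auto simp: K_def dest: inj_onD H.in_arcsD1 H.in_arcsD2)
  have "(u, v) \<in> parcs H \<Longrightarrow> (v, u) \<in> parcs H" for u v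
    using H.pair_sym_arcs by (auto simp: symmetric_def sym_def)
  then have "symmetric K"
    unfolding symmetric_def with_proj_simps by (intro symI) (force simp: K_def)
  moreover have "fst e \<noteq> snd e" if e: "e \<in> parcs K" for e
  proof -
    obtain u v where uv: "(u, v) \<in> parcs H" "e = (f u, f v)"
      using e by (auto simp: K_def)
    then show ?thesis
      using H.pair_no_loops[OF uv(1)] H.in_arcsD1[OF uv(1)] H.in_arcsD2[OF uv(1)] f
      by (auto dest: inj_onD)
  qed
  moreover have "fst e \<in> pverts K" "snd e \<in> pverts K" if "e \<in> parcs K" for e
    using that by (auto simp: K_def dest: H.in_arcsD1 H.in_arcsD2)
  moreover have "finite (pverts K)" "finite (parcs K)"
    using fin H.pair_finite_arcs by (simp_all add: K_def)
  ultimately have K: "pair_graph K"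
    by unfold_locales
  interpret K: pair_graph K by fact
  have "bij_betw f (pverts H) (pverts K)"
    using f by (simp add: bij_betw_def K_def)
  then have iso: "digraph_iso H K"
    unfolding digraph_iso_pair_iff[OF H.pair_wf_digraph_axioms K.pair_wf_digraph_axioms]
    using adj by blast
  obtain vs where vs: "set vs = pverts H" "distinct vs"
    using finite_distinct_list[OF fin] by blast
  have "(f (vs ! i), f (vs ! j)) \<in> parcs K \<longleftrightarrow> (vs ! i, vs ! j) \<in> parcs H"
    if "i < length vs" "j < length vs" for i j
    using adj[of "vs ! i" "vs ! j"] nth_mem[OF that(1)] nth_mem[OF that(2)]
    unfolding vs(1) by blast
  then have "adjacency_mat K (map f vs) = adjacency_mat H vs"
    by (intro eq_matI) (simp_all add: adjacency_mat_def)
  moreover have "graph_spectrum K = proots (char_poly (adjacency_mat K (map f vs)))"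
    using vs f by (intro graph_spectrum_eq) (auto simp: K_def distinct_map)
  ultimately have "cospectral G K"
    using \<open>cospectral G H\<close> graph_spectrum_eq[OF vs(2,1)] by (simp add: cospectral_def)
  with G K have "digraph_iso K G"
    by (auto simp: determined_by_spectrum_def)
  with iso show ?thesis by (rule digraph_iso_trans)
qed

end

theory Submission
  imports Defs
begin

text \<open>
  The cospectral mate arises by Wang--Qiu--Hu switching. Let \<open>C\<^sub>1\<close> consist of the three vertices
  \<open>{1, 2, 3, i}\<close> with \<open>i \<in> {4, 5, 6}\<close>, and \<open>C\<^sub>2\<close> of the three vertices \<open>{j, 4, 5, 6}\<close> with
  \<open>j \<in> {1, 2, 3}\<close>. A vertex outside \<open>C\<^sub>1 \<union> C\<^sub>2\<close> has equally many neighbours in \<open>C\<^sub>1\<close> and in \<open>C\<^sub>2\<close>,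
  unless it meets one of \<open>{1, 2, 3}\<close>, \<open>{4, 5, 6}\<close> in two points and misses the other; then it is
  adjacent to all of one of the \<open>C\<^sub>i\<close> and to none of the other. Interchanging the roles of \<open>C\<^sub>1\<close> and
  \<open>C\<^sub>2\<close> for these exceptional vertices conjugates the adjacency matrix by the reflection
  \<open>I - f f\<^sup>T / 3\<close>, where \<open>f\<close> is the indicator of \<open>C\<^sub>1\<close> minus that of \<open>C\<^sub>2\<close>.

  In the Johnson graph any two adjacent vertices have the same number of common neighbours. In the
  mate this fails: for \<open>n \<ge> 9\<close> the number drops for the edge between \<open>{1, 2, 3, 5}\<close> and
  \<open>{1, 2, 4, 7}\<close>, and for \<open>n = 8\<close>, where it does not, the new edge between \<open>{1, 4, 5, 6}\<close> and
  \<open>{1, 2, 7, 8}\<close> has too few.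
\<close>

section \<open>Cospectrality by conjugation with a reflection\<close>

text \<open>With \<open>Q = I - c f f^T\<close>, the normalization makes \<open>Q\<close> an
  involution and the intertwining hypothesis is the entrywise form of \<open>A Q = Q B\<close>.
  Hence \<open>A = Q B Q\<close> is similar to \<open>B\<close>, and the characteristic polynomials
  agree.\<close>

lemma cospectral_if_intertwined_by_reflection:
  fixes G :: "'a pair_pre_digraph" and H :: "'a pair_pre_digraph" and f :: "'a \<Rightarrow> real"
  assumes fin: "finite V" and G: "pverts G = V" and H: "pverts H = V"
    and norm: "c * (\<Sum>x\<in>V. f x * f x) = 2"
    and intertwine: "\<And>x y. x \<in> V \<Longrightarrow> y \<in> V \<Longrightarrow>
      of_bool ((x, y) \<in> parcs G) - c * (\<Sum>z\<in>V. of_bool ((x, z) \<in> parcs G) * f z) * f y =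
      of_bool ((x, y) \<in> parcs H) - c * f x * (\<Sum>z\<in>V. f z * of_bool ((z, y) \<in> parcs H))"
  shows "cospectral G H"
proof -
  obtain vs where vs: "set vs = V" "distinct vs"
    using finite_distinct_list[OF fin] by blast
  define m where "m = length vs"
  have sum_vs: "(\<Sum>k = 0..<m. F (vs ! k)) = (\<Sum>x\<in>V. F x)" for F :: "'a \<Rightarrow> real"
    by (rule sum.reindex_bij_betw, rule bij_betw_nth) (use vs in \<open>auto simp: m_def\<close>)
  have inV: "vs ! i \<in> V" if "i < m" for i
    using that vs by (auto simp: m_def)
  have nth_eq: "vs ! i = vs ! j \<longleftrightarrow> i = j" if "i < m" "j < m" for i j
    using that vs by (simp add: m_def nth_eq_iff_index_eq)
  define Q where "Q = mat m m (\<lambda>(i, j). of_bool (i = j) - c * f (vs ! i) * f (vs ! j))"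
  define A where "A = adjacency_mat G vs"
  define B where "B = adjacency_mat H vs"
  have carr: "Q \<in> carrier_mat m m" "A \<in> carrier_mat m m" "B \<in> carrier_mat m m"
    by (simp_all add: Q_def A_def B_def adjacency_mat_def m_def)
  have A: "A $$ (i, j) = of_bool ((vs ! i, vs ! j) \<in> parcs G)"
    and B: "B $$ (i, j) = of_bool ((vs ! i, vs ! j) \<in> parcs H)"
    and Q: "Q $$ (i, j) = of_bool (i = j) - c * f (vs ! i) * f (vs ! j)"
    if "i < m" "j < m" for i j
    using that by (simp_all add: A_def B_def Q_def adjacency_mat_def m_def)
  have times: "(M * N) $$ (i, j) = (\<Sum>k = 0..<m. M $$ (i, k) * N $$ (k, j))"
    if "i < m" "j < m" "M \<in> carrier_mat m m" "N \<in> carrier_mat m m" for M N :: "real mat" and i j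
    using that by (auto simp: scalar_prod_def intro!: sum.cong)
  have QQ: "Q * Q = 1\<^sub>m m"
  proof (rule eq_matI)
    fix i j assume ij: "i < dim_row (1\<^sub>m m :: real mat)" "j < dim_col (1\<^sub>m m :: real mat)"
    let ?x = "f (vs ! i)" and ?y = "f (vs ! j)"
    have "(Q * Q) $$ (i, j) = (\<Sum>k = 0..<m. of_bool (i = k) * of_bool (k = j)
        - of_bool (i = k) * (c * f (vs ! k) * ?y) - c * ?x * f (vs ! k) * of_bool (k = j)
        + c * ?x * (c * ?y) * (f (vs ! k) * f (vs ! k)))"
      using ij carr by (subst times) (auto simp: Q algebra_simps intro!: sum.cong)
    also have "\<dots> = of_bool (i = j) - c * ?x * ?y - c * ?x * ?y
        + c * ?x * ?y * (c * (\<Sum>k = 0..<m. f (vs ! k) * f (vs ! k)))"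
      using ij by (simp add: sum.distrib sum_subtractf sum_distrib_left[symmetric] of_bool_def
          if_distrib[of "\<lambda>u. u * _"] if_distrib[of "\<lambda>u. _ * u"] cong: if_cong)
    \<comment> \<open>By \<open>norm\<close> the last term is \<open>2 * c * ?x * ?y\<close>, which
      cancels the two subtracted ones.\<close>
    also have "\<dots> = of_bool (i = j)"
      using norm sum_vs[of "\<lambda>x. f x * f x"] by simp
    finally show "(Q * Q) $$ (i, j) = 1\<^sub>m m $$ (i, j)"
      using ij by simp
  qed (use carr in auto)
  have AQ: "A * Q = Q * B"
  proof (rule eq_matI)
    fix i j assume "i < dim_row (Q * B)" "j < dim_col (Q * B)"
    then have ij: "i < m" "j < m"
      using carr by auto
    let ?x = "vs ! i" and ?y = "vs ! j"
    have "(A * Q) $$ (i, j) = (\<Sum>k = 0..<m. of_bool ((?x, vs ! k) \<in> parcs G) * of_bool (k = j)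
        - of_bool ((?x, vs ! k) \<in> parcs G) * f (vs ! k) * (c * f ?y))"
      using ij carr by (subst times) (auto simp: Q A algebra_simps intro!: sum.cong)
    also have "\<dots> = of_bool ((?x, ?y) \<in> parcs G)
        - (\<Sum>k = 0..<m. of_bool ((?x, vs ! k) \<in> parcs G) * f (vs ! k)) * (c * f ?y)"
      using ij by (simp add: sum_subtractf sum_distrib_right[symmetric] of_bool_def
          if_distrib[of "\<lambda>u. _ * u"] cong: if_cong)
    also have "\<dots> = of_bool ((?x, ?y) \<in> parcs H)
        - c * f ?x * (\<Sum>k = 0..<m. f (vs ! k) * of_bool ((vs ! k, ?y) \<in> parcs H))"
      unfolding sum_vs[of "\<lambda>z. of_bool ((?x, z) \<in> parcs G) * f z"]
        sum_vs[of "\<lambda>z. f z * of_bool ((z, ?y) \<in> parcs H)"]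
      using intertwine[OF inV[OF ij(1)] inV[OF ij(2)]] by (simp add: mult_ac)
    also have "\<dots> = (\<Sum>k = 0..<m. of_bool (i = k) * of_bool ((vs ! k, ?y) \<in> parcs H)
        - c * f ?x * (f (vs ! k) * of_bool ((vs ! k, ?y) \<in> parcs H)))"
      using ij by (simp add: sum_subtractf sum_distrib_left[symmetric] of_bool_def
          if_distrib[of "\<lambda>u. u * _"] cong: if_cong)
    also have "\<dots> = (Q * B) $$ (i, j)"
      using ij carr by (subst times) (auto simp: Q B algebra_simps intro!: sum.cong)
    finally show "(A * Q) $$ (i, j) = (Q * B) $$ (i, j)" .
  qed (use carr in auto)
  have "A = A * (Q * Q)"
    using carr by (simp add: QQ)
  also have "\<dots> = Q * B * Q"
    using carr by (simp add: AQ flip: assoc_mult_mat[of A m m Q m Q m])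
  finally have "A = Q * B * Q" .
  then have "similar_mat A B"
    unfolding similar_mat_def
    by (intro exI[of _ Q] similar_mat_witI[OF QQ QQ]) (use carr in auto)
  then show ?thesis
    using vs G H by (simp add: cospectral_def graph_spectrum_eq[of vs] char_poly_similar A_def B_def)
qed

section \<open>Common neighbour counts as an isomorphism invariant\<close>

definition common_nbrs :: "'a pair_pre_digraph \<Rightarrow> 'a \<Rightarrow> 'a \<Rightarrow> 'a set" where
  "common_nbrs G x y = {z \<in> pverts G. (x, z) \<in> parcs G \<and> (y, z) \<in> parcs G}"

lemma card_common_nbrs_iso:
  assumes G: "pair_graph G" and H: "pair_graph H" and iso: "digraph_iso H G"
    and xy: "(x, y) \<in> parcs H"
  obtains x' y' where "(x', y') \<in> parcs G" "card (common_nbrs G x' y') = card (common_nbrs H x y)"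
proof -
  interpret G: pair_graph G by fact
  interpret H: pair_graph H by fact
  obtain f where f: "bij_betw f (pverts H) (pverts G)"
    and adj: "\<And>u v. u \<in> pverts H \<Longrightarrow> v \<in> pverts H \<Longrightarrow>
      (u, v) \<in> parcs H \<longleftrightarrow> (f u, f v) \<in> parcs G"
    using iso digraph_iso_pair_iff[OF H.pair_wf_digraph_axioms G.pair_wf_digraph_axioms] by blast
  have x: "x \<in> pverts H" and y: "y \<in> pverts H"
    using xy by (auto dest: H.in_arcsD1 H.in_arcsD2)
  have "common_nbrs G (f x) (f y) = f ` common_nbrs H x y"
    using f x y unfolding common_nbrs_def bij_betw_def by (fastforce simp: adj)
  moreover have "inj_on f (common_nbrs H x y)"
    using f by (auto simp: bij_betw_def common_nbrs_def intro: inj_on_subset)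
  ultimately have "card (common_nbrs G (f x) (f y)) = card (common_nbrs H x y)"
    by (simp add: card_image)
  then show ?thesis
    using that[of "f x" "f y"] adj x y xy by blast
qed

text \<open>The cells \<open>x \<inter> y\<close>, \<open>x - y\<close>, \<open>y - x\<close> and
  the rest of \<open>U\<close> have the same sizes as their primed counterparts, so bijections
  between corresponding cells can be glued.\<close>

lemma bij_betw_respecting_two_subsets:
  assumes "finite U" "x \<subseteq> U" "y \<subseteq> U" "x' \<subseteq> U" "y' \<subseteq> U"
    and "card x = card x'" "card y = card y'" "card (x \<inter> y) = card (x' \<inter> y')"
  obtains p where "bij_betw p U U" "p ` x = x'" "p ` y = y'"
proof -
  have fin: "finite x" "finite y" "finite x'" "finite y'"
    using assms(1-5) by (auto intro: finite_subset)
  have c: "card (x - y) = card (x' - y')" "card (y - x) = card (y' - x')"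
    using assms fin by (simp_all add: card_Diff_subset_Int Int_commute)
  moreover have "card (x \<union> y) = card (x' \<union> y')"
    using card_Un_Int[OF fin(1,2)] card_Un_Int[OF fin(3,4)] assms by simp
  then have "card (U - (x \<union> y)) = card (U - (x' \<union> y'))"
    using assms fin by (simp add: card_Diff_subset)
  ultimately obtain p1 p2 p3 p4 where
    p1: "bij_betw p1 (x \<inter> y) (x' \<inter> y')" and p2: "bij_betw p2 (x - y) (x' - y')" and
    p3: "bij_betw p3 (y - x) (y' - x')" and p4: "bij_betw p4 (U - (x \<union> y)) (U - (x' \<union> y'))"
    using assms fin finite_same_card_bij[of "x \<inter> y" "x' \<inter> y'"]
      finite_same_card_bij[of "x - y" "x' - y'"] finite_same_card_bij[of "y - x" "y' - x'"]
      finite_same_card_bij[of "U - (x \<union> y)" "U - (x' \<union> y')"] by auto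
  define p where "p u = (if u \<in> x then if u \<in> y then p1 u else p2 u
    else if u \<in> y then p3 u else p4 u)" for u
  have p1: "bij_betw p (x \<inter> y) (x' \<inter> y')"
    using p1 by (rule bij_betw_cong[THEN iffD1, rotated]) (simp add: p_def)
  have p2: "bij_betw p (x - y) (x' - y')"
    using p2 by (rule bij_betw_cong[THEN iffD1, rotated]) (simp add: p_def)
  have p3: "bij_betw p (y - x) (y' - x')"
    using p3 by (rule bij_betw_cong[THEN iffD1, rotated]) (simp add: p_def)
  have p4: "bij_betw p (U - (x \<union> y)) (U - (x' \<union> y'))"
    using p4 by (rule bij_betw_cong[THEN iffD1, rotated]) (simp add: p_def)
  have px: "bij_betw p ((x \<inter> y) \<union> (x - y)) ((x' \<inter> y') \<union> (x' - y'))"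
    using p1 p2 by (rule bij_betw_combine) auto
  have py: "bij_betw p ((x \<inter> y) \<union> (y - x)) ((x' \<inter> y') \<union> (y' - x'))"
    using p1 p3 by (rule bij_betw_combine) auto
  have "bij_betw p (((x \<inter> y) \<union> (x - y)) \<union> (y - x)) (((x' \<inter> y') \<union> (x' - y')) \<union> (y' - x'))"
    using px p3 by (rule bij_betw_combine) auto
  then have "bij_betw p ((((x \<inter> y) \<union> (x - y)) \<union> (y - x)) \<union> (U - (x \<union> y)))
     ((((x' \<inter> y') \<union> (x' - y')) \<union> (y' - x')) \<union> (U - (x' \<union> y')))"
    using p4 by (rule bij_betw_combine) auto
  moreover have "(((x \<inter> y) \<union> (x - y)) \<union> (y - x)) \<union> (U - (x \<union> y)) = U"
    "(((x' \<inter> y') \<union> (x' - y')) \<union> (y' - x')) \<union> (U - (x' \<union> y')) = U"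
    using assms by auto
  ultimately have "bij_betw p U U" by simp
  moreover have "(x \<inter> y) \<union> (x - y) = x" "(x' \<inter> y') \<union> (x' - y') = x'"
    "(x \<inter> y) \<union> (y - x) = y" "(x' \<inter> y') \<union> (y' - x') = y'"
    by auto
  then have "p ` x = x'" "p ` y = y'"
    using bij_betw_imp_surj_on[OF px] bij_betw_imp_surj_on[OF py] by argo+
  ultimately show ?thesis using that by blast
qed

text \<open>Some permutation of the ground set carries the first pair to the second. It preserves
  sizes of sets and of their intersections, so it acts as an automorphism and maps common neighbours
  onto common neighbours.\<close>

lemma card_common_nbrs_johnson_graph:
  fixes S :: "nat set" and n k :: nat
  defines "V \<equiv> pverts (johnson_graph S n k)"
  assumes V: "x \<in> V" "y \<in> V" "x' \<in> V" "y' \<in> V" and "card (x \<inter> y) = card (x' \<inter> y')"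
  shows "card (common_nbrs (johnson_graph S n k) x y) =
    card (common_nbrs (johnson_graph S n k) x' y')"
proof -
  obtain p where p: "bij_betw p {1..n} {1..n}" "p ` x = x'" "p ` y = y'"
    using assms by (elim bij_betw_respecting_two_subsets[of "{1..n}" x y x' y', rotated -1])
      (auto simp: johnson_graph_def Let_def)
  have inj: "inj_on p {1..n}"
    using p by (simp add: bij_betw_def)
  have sub: "x \<subseteq> {1..n}" "y \<subseteq> {1..n}"
    using V by (auto simp: V_def johnson_graph_def)
  have card: "card (p ` u) = card u" if "u \<subseteq> {1..n}" for u
    using card_image inj inj_on_subset that by blast
  have card_Int: "card (p ` u \<inter> p ` v) = card (u \<inter> v)" if "u \<subseteq> {1..n}" "v \<subseteq> {1..n}" for u v
    using that card[of "u \<inter> v"] inj_on_image_Int[OF inj that] by auto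
  have mem: "p ` z \<in> common_nbrs (johnson_graph S n k) x' y' \<longleftrightarrow>
      z \<in> common_nbrs (johnson_graph S n k) x y" if "z \<subseteq> {1..n}" for z
  proof -
    have "p ` z \<subseteq> {1..n}"
      using p(1) that by (auto simp: bij_betw_def)
    then show ?thesis
      using V that sub card[OF that] card_Int[OF sub(1) that] card_Int[OF sub(2) that]
      unfolding common_nbrs_def johnson_graph_def V_def p(2,3) by simp
  qed
  have "common_nbrs (johnson_graph S n k) x' y' = (`) p ` common_nbrs (johnson_graph S n k) x y"
  proof (intro equalityI subsetI)
    fix w assume w: "w \<in> common_nbrs (johnson_graph S n k) x' y'"
    then have "w \<in> (`) p ` Pow {1..n}"
      unfolding bij_betw_imp_surj_on[OF bij_betw_Pow[OF p(1)]]
      by (simp add: common_nbrs_def johnson_graph_def)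
    then obtain z where "z \<subseteq> {1..n}" "w = p ` z"
      by (elim imageE PowD[elim_format])
    then show "w \<in> (`) p ` common_nbrs (johnson_graph S n k) x y"
      using w mem by blast
  next
    fix w assume "w \<in> (`) p ` common_nbrs (johnson_graph S n k) x y"
    then obtain z where z: "z \<in> common_nbrs (johnson_graph S n k) x y" "w = p ` z"
      by blast
    then have "z \<subseteq> {1..n}"
      by (simp add: common_nbrs_def johnson_graph_def)
    then show "w \<in> common_nbrs (johnson_graph S n k) x' y'"
      using z mem by blast
  qed
  moreover have "inj_on ((`) p) (common_nbrs (johnson_graph S n k) x y)"
    by (rule inj_on_subset[OF bij_betw_imp_inj_on[OF bij_betw_Pow[OF p(1)]]])
      (auto simp: common_nbrs_def johnson_graph_def)
  ultimately show ?thesis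
    by (simp add: card_image)
qed

section \<open>The switched graph\<close>

text \<open>
  \<open>C\<^sub>1\<close> and \<open>C\<^sub>2\<close> are the vertices of profile \<open>(3, 1)\<close> and \<open>(1, 3)\<close>, the exceptional vertices those of
  profile \<open>(2, 0)\<close> and \<open>(0, 2)\<close>.
\<close>

definition profile :: "nat set \<Rightarrow> nat \<times> nat" where
  "profile A = (card (A \<inter> {1, 2, 3}), card (A \<inter> {4, 5, 6}))"

definition flipped :: "nat set \<Rightarrow> nat set \<Rightarrow> bool" where
  "flipped A B \<longleftrightarrow> profile A \<in> {(3, 1), (1, 3)} \<and> profile B \<in> {(2, 0), (0, 2)}"

text \<open>Here \<open>\<noteq>\<close> is exclusive or: flipped pairs have their adjacency
  complemented. For a vertex joined to all of one half of the core and to none of the other, this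
  interchanges the halves.\<close>

definition mate_adj :: "nat set \<Rightarrow> nat set \<Rightarrow> bool" where
  "mate_adj A B \<longleftrightarrow> (card (A \<inter> B) = 2) \<noteq> (flipped A B \<or> flipped B A)"

definition mate :: "nat \<Rightarrow> nat set pair_pre_digraph" where
  "mate n =
     (let V = {A. A \<subseteq> {1..n} \<and> card A = 4}
      in \<lparr>pverts = V, parcs = {(A, B). A \<in> V \<and> B \<in> V \<and> mate_adj A B}\<rparr>)"

definition core_sign :: "nat set \<Rightarrow> real" where
  "core_sign A = (if profile A = (3, 1) then 1 else if profile A = (1, 3) then - 1 else 0)"

lemma pair_graph_mate: "pair_graph (mate n)"
proof -
  have fin: "finite {A. A \<subseteq> {1..n} \<and> card A = 4}"
    by (rule finite_subset[of _ "Pow {1..n}"]) auto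
  have "parcs (mate n) \<subseteq> {A. A \<subseteq> {1..n} \<and> card A = 4} \<times> {A. A \<subseteq> {1..n} \<and> card A = 4}"
    by (auto simp: mate_def Let_def)
  then have "finite (parcs (mate n))"
    by (rule finite_subset) (use fin in blast)
  moreover have "finite (pverts (mate n))"
    using fin by (simp add: mate_def Let_def)
  moreover have "symmetric (mate n)"
    unfolding symmetric_def with_proj_simps
    by (rule symI) (auto simp: mate_def Let_def mate_adj_def Int_commute)
  moreover have "fst e \<noteq> snd e" "fst e \<in> pverts (mate n)" "snd e \<in> pverts (mate n)"
    if "e \<in> parcs (mate n)" for e
    using that by (auto simp: mate_def Let_def mate_adj_def flipped_def)
  ultimately show ?thesis
    by unfold_locales
qed

section \<open>Sums over the core, and cospectrality of the mate\<close>

text \<open>Turns intersection sizes into sums of membership bits, so that claims about profiles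
  reduce to case splits on which of \<open>1\<close> to \<open>6\<close> belong to a set.\<close>

lemma card_Int_insert:
  assumes "finite B" "x \<notin> B"
  shows "card (A \<inter> insert x B) = of_bool (x \<in> A) + card (A \<inter> B)"
  using assms by (simp add: Int_insert_right)

definition core :: "nat set set" where
  "core = {{1, 2, 3, 4}, {1, 2, 3, 5}, {1, 2, 3, 6}, {1, 4, 5, 6}, {2, 4, 5, 6}, {3, 4, 5, 6}}"

text \<open>The profiles \<open>(3, 1)\<close> and \<open>(1, 3)\<close> already use up four
  elements, leaving no room for a point outside \<open>{1, 2, 3, 4, 5, 6}\<close>.\<close>

lemma core_if_core_sign:
  assumes "card A = 4" "core_sign A \<noteq> 0"
  shows "A \<in> core"
proof -
  have fin: "finite A"
    using assms(1) by (simp add: card_ge_0_finite)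
  have "profile A = (3, 1) \<or> profile A = (1, 3)"
    using assms by (auto simp: core_sign_def split: if_splits)
  then have "\<exists>B\<in>core. B \<subseteq> A"
    by (cases "1 \<in> A"; cases "2 \<in> A"; cases "3 \<in> A"; cases "4 \<in> A"; cases "5 \<in> A"; cases "6 \<in> A";
        simp add: core_def profile_def card_Int_insert)
  then obtain B where B: "B \<in> core" "B \<subseteq> A"
    by blast
  have "card B = 4"
    using B(1) by (auto simp: core_def)
  then have "B = A"
    using card_subset_eq[OF fin B(2)] assms(1) by simp
  then show ?thesis
    using B(1) by simp
qed

lemma sum_core_sign:
  fixes F :: "nat set \<Rightarrow> real"
  assumes "n \<ge> 6"
  shows "(\<Sum>A | A \<subseteq> {1..n} \<and> card A = 4. core_sign A * F A) =
    F {1, 2, 3, 4} + F {1, 2, 3, 5} + F {1, 2, 3, 6}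
    - F {1, 4, 5, 6} - F {2, 4, 5, 6} - F {3, 4, 5, 6}"
proof -
  have "(\<Sum>A | A \<subseteq> {1..n} \<and> card A = 4. core_sign A * F A) = (\<Sum>A\<in>core. core_sign A * F A)"
  proof (rule sum.mono_neutral_right)
    show "finite {A. A \<subseteq> {1..n} \<and> card A = 4}"
      by (rule finite_subset[of _ "Pow {1..n}"]) auto
    show "core \<subseteq> {A. A \<subseteq> {1..n} \<and> card A = 4}"
      using assms by (auto simp: core_def)
    show "\<forall>A\<in>{A. A \<subseteq> {1..n} \<and> card A = 4} - core. core_sign A * F A = 0"
      using core_if_core_sign by fastforce
  qed
  then show ?thesis
    by (simp add: core_def core_sign_def profile_def set_eq_subset)
qed

text \<open>The sign tells which half of the core an exceptional vertex is adjacent to in the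
  Johnson graph: the half of the same \<open>core_sign\<close>.\<close>

definition switch_weight :: "nat set \<Rightarrow> real" where
  "switch_weight A = (if profile A = (2, 0) then 1 else if profile A = (0, 2) then - 1 else 0)"

text \<open>Writing \<open>f\<close> for \<open>core_sign\<close>, \<open>g\<close> for
  \<open>switch_weight\<close> and \<open>J\<close> for the Johnson adjacency matrix, this is
  \<open>J f = 3 g - 3 f\<close>. All terms depend only on the trace of \<open>A\<close> on
  \<open>{1, 2, 3, 4, 5, 6}\<close>, which leaves finitely many cases.\<close>

lemma sum_johnson_core_sign:
  assumes "n \<ge> 6"
  shows "(\<Sum>B | B \<subseteq> {1..n} \<and> card B = 4. core_sign B * of_bool (card (B \<inter> A) = 2)) =
    3 * switch_weight A - 3 * core_sign A"
  unfolding sum_core_sign[OF assms] Int_commute[of _ A]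
  by (cases "1 \<in> A"; cases "2 \<in> A"; cases "3 \<in> A"; cases "4 \<in> A"; cases "5 \<in> A"; cases "6 \<in> A";
      simp add: card_Int_insert switch_weight_def core_sign_def profile_def)

lemma mate_adj_core:
  assumes "B \<in> core"
  shows "mate_adj B A \<longleftrightarrow> (card (B \<inter> A) = 2) \<noteq> (switch_weight A \<noteq> 0)"
  using assms by (auto simp: core_def mate_adj_def flipped_def switch_weight_def profile_def)

text \<open>Switching changes only the sign of \<open>g\<close>. At an exceptional vertex, adjacency
  to the core is complemented; since \<open>core_sign\<close> sums to zero, complementing negates
  the weighted sum.\<close>

lemma sum_mate_core_sign:
  assumes "n \<ge> 6"
  shows "(\<Sum>B | B \<subseteq> {1..n} \<and> card B = 4. core_sign B * of_bool (mate_adj B A)) =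
    - 3 * switch_weight A - 3 * core_sign A"
proof (cases "switch_weight A = 0")
  case True
  then have "(\<Sum>B | B \<subseteq> {1..n} \<and> card B = 4. core_sign B * of_bool (mate_adj B A)) =
     (\<Sum>B | B \<subseteq> {1..n} \<and> card B = 4. core_sign B * of_bool (card (B \<inter> A) = 2))"
    unfolding sum_core_sign[OF assms] by (simp add: mate_adj_core core_def)
  then show ?thesis
    using True sum_johnson_core_sign[OF assms] by simp
next
  case False
  then have "core_sign B * of_bool (mate_adj B A) =
      core_sign B * 1 - core_sign B * of_bool (card (B \<inter> A) = 2)" if "card B = 4" for B
    using mate_adj_core[OF core_if_core_sign[OF that]] by (cases "core_sign B = 0") auto
  then have "(\<Sum>B | B \<subseteq> {1..n} \<and> card B = 4. core_sign B * of_bool (mate_adj B A)) =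
     (\<Sum>B | B \<subseteq> {1..n} \<and> card B = 4. core_sign B * 1) -
     (\<Sum>B | B \<subseteq> {1..n} \<and> card B = 4. core_sign B * of_bool (card (B \<inter> A) = 2))"
    unfolding sum_subtractf[symmetric] by (intro sum.cong) auto
  moreover have "core_sign A = 0"
    using False by (auto simp: switch_weight_def core_sign_def split: if_splits)
  ultimately show ?thesis
    unfolding sum_core_sign[OF assms, of "\<lambda>_. 1"] sum_johnson_core_sign[OF assms] by simp
qed

text \<open>Encodes the all-or-nothing adjacency linearly: the product of the signs is
  \<open>1\<close> on the adjacent half and \<open>- 1\<close> on the other.\<close>

lemma johnson_adj_core:
  assumes "switch_weight A \<noteq> 0"
  shows "\<forall>B\<in>core. of_bool (card (B \<inter> A) = 2) = (1 + core_sign B * switch_weight A) / 2"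
proof -
  have "core_sign {1, 2, 3, 4} = 1" "core_sign {1, 2, 3, 5} = 1" "core_sign {1, 2, 3, 6} = 1"
    "core_sign {1, 4, 5, 6} = - 1" "core_sign {2, 4, 5, 6} = - 1" "core_sign {3, 4, 5, 6} = - 1"
    by (simp_all add: core_sign_def profile_def)
  then show ?thesis
    using assms unfolding Int_commute[of _ A]
    by (cases "1 \<in> A"; cases "2 \<in> A"; cases "3 \<in> A"; cases "4 \<in> A"; cases "5 \<in> A"; cases "6 \<in> A";
        simp add: core_def switch_weight_def profile_def card_Int_insert)
qed

text \<open>In matrix form the mate is \<open>M = J - f g^T - g f^T\<close>. On a flipped pair the
  old entry is \<open>(1 + s) / 2\<close> with \<open>s\<close> the product of the signs, so its
  complement \<open>(1 - s) / 2\<close> arises by subtracting \<open>s\<close>.\<close>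

lemma mate_adj_eq:
  assumes "card A = 4" "card B = 4"
  shows "of_bool (mate_adj A B) =
    of_bool (card (A \<inter> B) = 2) - core_sign A * switch_weight B - switch_weight A * core_sign B"
proof -
  have F: "flipped A B \<longleftrightarrow> core_sign A \<noteq> 0 \<and> switch_weight B \<noteq> 0" for A B
    by (auto simp: flipped_def core_sign_def switch_weight_def)
  \<comment> \<open>Core and exceptional profiles are disjoint, so at most one of the two correction
    terms is nonzero.\<close>
  have excl: "core_sign A = 0 \<or> switch_weight A = 0" for A
    by (auto simp: core_sign_def switch_weight_def)
  consider "flipped A B" | "flipped B A" | "\<not> flipped A B" "\<not> flipped B A" by blast
  then show ?thesis
  proof cases
    case 1
    then show ?thesis
      using johnson_adj_core[of B] core_if_core_sign[OF assms(1)] excl[of A] excl[of B]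
      by (auto simp: mate_adj_def F split: if_splits)
  next
    case 2
    then show ?thesis
      using johnson_adj_core[of A] core_if_core_sign[OF assms(2)] excl[of A] excl[of B]
      by (auto simp: mate_adj_def F Int_commute mult.commute[of "switch_weight A"] split: if_splits)
  next
    case 3
    then show ?thesis
      using excl[of A] excl[of B] by (auto simp: mate_adj_def F)
  qed
qed

text \<open>The six core vertices give \<open>f^T f = 6\<close>, hence \<open>c = 1 / 3\<close>.
  Both sides of the intertwining relation then equal \<open>J - g f^T + f f^T\<close>.\<close>

lemma cospectral_johnson_graph_mate:
  assumes "n \<ge> 6"
  shows "cospectral (johnson_graph {2} n 4) (mate n)"
proof (rule cospectral_if_intertwined_by_reflection)
  let ?V = "{A. A \<subseteq> {1..n} \<and> card A = 4}"
  show "finite ?V"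
    by (rule finite_subset[of _ "Pow {1..n}"]) auto
  show "pverts (johnson_graph {2} n 4) = ?V" "pverts (mate n) = ?V"
    by (simp_all add: johnson_graph_def mate_def)
  show "1 / 3 * (\<Sum>A\<in>?V. core_sign A * core_sign A) = 2"
    unfolding sum_core_sign[OF assms] by (simp add: core_sign_def profile_def)
  fix A B assume AB: "A \<in> ?V" "B \<in> ?V"
  have J: "(\<Sum>C\<in>?V. of_bool ((A, C) \<in> parcs (johnson_graph {2} n 4)) * core_sign C) =
      3 * switch_weight A - 3 * core_sign A"
    unfolding sum_johnson_core_sign[OF assms, symmetric]
    using AB by (intro sum.cong) (auto simp: johnson_graph_def Int_commute)
  have M: "(\<Sum>C\<in>?V. core_sign C * of_bool ((C, B) \<in> parcs (mate n))) =
      - 3 * switch_weight B - 3 * core_sign B"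
    unfolding sum_mate_core_sign[OF assms, symmetric]
    using AB by (intro sum.cong) (auto simp: mate_def)
  have "of_bool ((A, B) \<in> parcs (mate n)) = of_bool ((A, B) \<in> parcs (johnson_graph {2} n 4))
      - core_sign A * switch_weight B - switch_weight A * core_sign B"
    using AB mate_adj_eq[of A B] by (simp add: johnson_graph_def mate_def)
  then show "of_bool ((A, B) \<in> parcs (johnson_graph {2} n 4)) - 1 / 3 *
      (\<Sum>C\<in>?V. of_bool ((A, C) \<in> parcs (johnson_graph {2} n 4)) * core_sign C) * core_sign B =
      of_bool ((A, B) \<in> parcs (mate n)) - 1 / 3 * core_sign A *
      (\<Sum>C\<in>?V. core_sign C * of_bool ((C, B) \<in> parcs (mate n)))"
    unfolding J M by (simp add: algebra_simps)
qed

section \<open>Comparing common neighbour counts in the two graphs\<close>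

text \<open>Makes counting subsets executable: \<open>subseqs\<close> of a distinct list yields
  every subset exactly once.\<close>

lemma card_subsets_eq_length_filter:
  assumes "distinct xs"
  shows "card {A. A \<subseteq> set xs \<and> P A} = length (filter P (map set (subseqs xs)))"
proof -
  have "{A. A \<subseteq> set xs \<and> P A} = set (filter P (map set (subseqs xs)))"
    using subseqs_powset[of xs] by auto
  moreover have "distinct (filter P (map set (subseqs xs)))"
    using distinct_set_subseqs[OF assms] by simp
  ultimately show ?thesis
    using distinct_card by metis
qed

lemma common_nbrs_johnson_graph_4:
  assumes "x \<subseteq> {1..n}" "card x = 4" "y \<subseteq> {1..n}" "card y = 4"
  shows "common_nbrs (johnson_graph {2} n 4) x y =
    {A. A \<subseteq> {1..n} \<and> card A = 4 \<and> card (x \<inter> A) = 2 \<and> card (y \<inter> A) = 2}"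
  using assms by (auto simp: common_nbrs_def johnson_graph_def)

lemma common_nbrs_mate:
  assumes "x \<subseteq> {1..n}" "card x = 4" "y \<subseteq> {1..n}" "card y = 4"
  shows "common_nbrs (mate n) x y =
    {A. A \<subseteq> {1..n} \<and> card A = 4 \<and> mate_adj x A \<and> mate_adj y A}"
  using assms by (auto simp: common_nbrs_def mate_def)

text \<open>Evaluated over all subsets of an eight-element set. The first pair is an edge of the
  Johnson graph, the second an edge created by the switching.\<close>

lemma card_common_nbrs_8:
  "card (common_nbrs (johnson_graph {2} 8 4) {1, 2, 3, 4} {1, 2, 5, 6}) = 18"
  "card (common_nbrs (mate 8) {1, 4, 5, 6} {1, 2, 7, 8}) = 12"
proof -
  have C: "card {A. A \<subseteq> {1..8} \<and> P A} =
      length (filter P (map set (subseqs [1, 2, 3, 4, 5, 6, 7, 8 :: nat])))" for P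
  proof -
    have S: "{1..8} = set [1, 2, 3, 4, 5, 6, 7, 8 :: nat]"
      by code_simp
    show ?thesis
      unfolding S by (rule card_subsets_eq_length_filter) simp
  qed
  have J: "common_nbrs (johnson_graph {2} 8 4) {1, 2, 3, 4} {1, 2, 5, 6} = {A. A \<subseteq> {1..8} \<and>
      card A = 4 \<and> card ({1, 2, 3, 4} \<inter> A) = 2 \<and> card ({1, 2, 5, 6} \<inter> A) = 2}"
    by (rule common_nbrs_johnson_graph_4) auto
  show "card (common_nbrs (johnson_graph {2} 8 4) {1, 2, 3, 4} {1, 2, 5, 6}) = 18"
    unfolding J C by code_simp
  have M: "common_nbrs (mate 8) {1, 4, 5, 6} {1, 2, 7, 8} = {A. A \<subseteq> {1..8} \<and>
      card A = 4 \<and> mate_adj {1, 4, 5, 6} A \<and> mate_adj {1, 2, 7, 8} A}"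
    by (rule common_nbrs_mate) auto
  show "card (common_nbrs (mate 8) {1, 4, 5, 6} {1, 2, 7, 8}) = 12"
    unfolding M C by code_simp
qed

text \<open>An involution sending \<open>4\<close> to \<open>3\<close> and \<open>5\<close>,
  \<open>6\<close> to \<open>1\<close>, \<open>2\<close>, with \<open>7\<close> fixed: a set
  containing \<open>4\<close>, \<open>7\<close> and one of \<open>5\<close>, \<open>6\<close> then
  still meets \<open>{1, 2, 4, 7}\<close> in two points after the exchange.\<close>

definition swap_halves :: "nat \<Rightarrow> nat" where
  "swap_halves = id(1 := 5, 2 := 6, 3 := 4, 4 := 3, 5 := 1, 6 := 2)"

lemma swap_halves_swap_halves [simp]: "swap_halves (swap_halves k) = k"
proof -
  consider "k = 1" | "k = 2" | "k = 3" | "k = 4" | "k = 5" | "k = 6" | "k \<notin> {1, 2, 3, 4, 5, 6}"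
    by blast
  then show ?thesis
    by cases (simp_all add: swap_halves_def)
qed

lemma in_image_swap_halves: "k \<in> swap_halves ` A \<longleftrightarrow> swap_halves k \<in> A"
proof
  assume "swap_halves k \<in> A"
  then have "swap_halves (swap_halves k) \<in> swap_halves ` A"
    by (rule imageI)
  then show "k \<in> swap_halves ` A"
    by simp
qed auto

text \<open>The vertex \<open>{1, 2, 3, 5}\<close> is in the core, while \<open>{1, 2, 4, 7}\<close>
  is neither in the core nor exceptional. Switching therefore alters only adjacencies of the former
  to exceptional vertices: the common neighbours of profile \<open>(2, 0)\<close> are replaced by
  candidates of profile \<open>(0, 2)\<close>, which are fewer.\<close>

lemma card_common_nbrs_mate_less:
  assumes "n \<ge> 9"
  shows "card (common_nbrs (mate n) {1, 2, 3, 5} {1, 2, 4, 7}) <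
    card (common_nbrs (johnson_graph {2} n 4) {1, 2, 3, 5} {1, 2, 4, 7})"
proof -
  define N where "N = {A. A \<subseteq> {1..n} \<and> card A = 4 \<and> card ({1, 2, 4, 7} \<inter> A) = 2}"
  define K where "K = {A \<in> N. card ({1, 2, 3, 5} \<inter> A) = 2 \<and> profile A \<notin> {(2, 0), (0, 2)}}"
  define E\<^sub>1 where "E\<^sub>1 = {A \<in> N. profile A = (2, 0)}"
  define E\<^sub>2 where "E\<^sub>2 = {A \<in> N. profile A = (0, 2)}"
  have "finite N"
    unfolding N_def by (rule finite_subset[of _ "Pow {1..n}"]) auto
  then have fin: "finite K" "finite E\<^sub>1" "finite E\<^sub>2"
    by (simp_all add: K_def E\<^sub>1_def E\<^sub>2_def)
  have p: "profile {1, 2, 3, 5} = (3, 1)" "profile {1, 2, 4, 7} = (2, 1)"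
    by code_simp+
  have x: "card ({1, 2, 3, 5} \<inter> A) = 2" if "profile A = (2, 0)" for A
    using that unfolding Int_commute[of _ A]
    by (cases "1 \<in> A"; cases "2 \<in> A"; cases "3 \<in> A"; cases "5 \<in> A";
        simp add: profile_def card_Int_insert)
  have x': "card ({1, 2, 3, 5} \<inter> A) \<noteq> 2" if "profile A = (0, 2)" for A
    using that unfolding Int_commute[of _ A]
    by (cases "1 \<in> A"; cases "2 \<in> A"; cases "3 \<in> A"; cases "5 \<in> A";
        simp add: profile_def card_Int_insert)
  have "common_nbrs (johnson_graph {2} n 4) {1, 2, 3, 5} {1, 2, 4, 7} = K \<union> E\<^sub>1"
    using assms x x' by (subst common_nbrs_johnson_graph_4) (auto simp: N_def K_def E\<^sub>1_def)
  moreover have "K \<inter> E\<^sub>1 = {}" "K \<inter> E\<^sub>2 = {}"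
    by (auto simp: K_def E\<^sub>1_def E\<^sub>2_def)
  moreover have "common_nbrs (mate n) {1, 2, 3, 5} {1, 2, 4, 7} = K \<union> E\<^sub>2"
  proof -
    have "mate_adj {1, 2, 3, 5} A \<longleftrightarrow>
        (card ({1, 2, 3, 5} \<inter> A) = 2) \<noteq> (profile A \<in> {(2, 0), (0, 2)})"
      and "mate_adj {1, 2, 4, 7} A \<longleftrightarrow> card ({1, 2, 4, 7} \<inter> A) = 2" for A
      unfolding mate_adj_def flipped_def p by simp_all
    then have "common_nbrs (mate n) {1, 2, 3, 5} {1, 2, 4, 7} =
        {A \<in> N. (card ({1, 2, 3, 5} \<inter> A) = 2) \<noteq> (profile A \<in> {(2, 0), (0, 2)})}"
      unfolding N_def using assms by (subst common_nbrs_mate) auto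
    also have "\<dots> = K \<union> E\<^sub>2"
      using x x' unfolding K_def E\<^sub>2_def by blast
    finally show ?thesis .
  qed
  \<comment> \<open>exchanging \<open>{1, 2, 3}\<close> and \<open>{4, 5, 6}\<close> embeds \<open>E\<^sub>2\<close> into \<open>E\<^sub>1\<close> and misses \<open>{1, 2, 8, 9}\<close>\<close>
  moreover have "card E\<^sub>2 < card E\<^sub>1"
  proof -
    have swap_halves: "swap_halves 1 = 5" "swap_halves (Suc 0) = 5" "swap_halves 2 = 6"
      "swap_halves 3 = 4" "swap_halves 4 = 3" "swap_halves 5 = 1" "swap_halves 6 = 2"
      "swap_halves 7 = 7"
      by (simp_all add: swap_halves_def)
    have inj: "inj_on swap_halves A" for A
      by (rule inj_on_inverseI[of _ swap_halves]) simp
    have "swap_halves ` A \<in> E\<^sub>1" if A: "A \<in> E\<^sub>2" for A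
    proof -
      have c: "card (A \<inter> {1, 2, 3}) = 0" "card (A \<inter> {4, 5, 6}) = 2" "card (A \<inter> {1, 2, 4, 7}) = 2"
        using A by (auto simp only: E\<^sub>2_def N_def profile_def Int_commute mem_Collect_eq prod.inject)
      have 1: "1 \<notin> A" "2 \<notin> A" "3 \<notin> A"
        using c(1) by (simp_all add: card_Int_insert)
      \<comment> \<open>Without \<open>1\<close> and \<open>2\<close>, only \<open>4\<close> and
        \<open>7\<close> remain to meet \<open>{1, 2, 4, 7}\<close> in two points.\<close>
      have 2: "4 \<in> A" "7 \<in> A"
        using 1(1,2) c(3) by (cases "4 \<in> A"; cases "7 \<in> A"; simp add: card_Int_insert)+
      have 3: "5 \<in> A \<longleftrightarrow> 6 \<notin> A"
        using 2(1) c(2) by (cases "5 \<in> A"; cases "6 \<in> A"; simp add: card_Int_insert)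
      have "swap_halves ` A \<subseteq> {1..n}"
        using A assms by (auto simp: E\<^sub>2_def N_def swap_halves_def)
      moreover have "card (swap_halves ` A) = 4"
        using A by (simp add: card_image[OF inj] E\<^sub>2_def N_def)
      moreover have "card (swap_halves ` A \<inter> {1, 2, 4, 7}) = 2" "profile (swap_halves ` A) = (2, 0)"
        using 1 2 3 by (simp_all add: profile_def card_Int_insert in_image_swap_halves swap_halves)
      ultimately show ?thesis
        by (simp add: E\<^sub>1_def N_def Int_commute)
    qed
    moreover have "{1, 2, 8, 9} \<in> E\<^sub>1"
      using assms by (auto simp: E\<^sub>1_def N_def profile_def)
    moreover have "{1, 2, 8, 9} \<noteq> swap_halves ` A" if A: "A \<in> E\<^sub>2" for A
    proof
      assume eq: "{1, 2, 8, 9} = swap_halves ` A"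
      have "A = swap_halves ` {1, 2, 8, 9}"
        unfolding eq by (simp add: image_image)
      then have "A = {8, 9, 5, 6}"
        by (simp add: swap_halves_def)
      then show False
        using A by (simp add: E\<^sub>2_def N_def)
    qed
    ultimately have "(`) swap_halves ` E\<^sub>2 \<subset> E\<^sub>1"
      by blast
    then have "card ((`) swap_halves ` E\<^sub>2) < card E\<^sub>1"
      by (rule psubset_card_mono[OF fin(2)])
    moreover have "inj_on ((`) swap_halves) E\<^sub>2"
      by (rule inj_on_inverseI[of _ "(`) swap_halves"]) (simp add: image_image)
    ultimately show ?thesis
      by (simp add: card_image)
  qed
  ultimately show ?thesis
    using fin by (simp add: card_Un_disjoint)
qed

lemma not_digraph_iso_mate:
  assumes n: "n \<ge> 8"
  shows "\<not> digraph_iso (mate n) (johnson_graph {2} n 4)"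
proof
  assume iso: "digraph_iso (mate n) (johnson_graph {2} n 4)"
  have J: "pair_graph (johnson_graph {2} n 4)"
    by (rule pair_graph_johnson_graph) simp
  \<comment> \<open>An isomorphism would give every edge of the mate the common neighbour count
    shared by all Johnson edges, so any Johnson edge may serve for comparison.\<close>
  have const: "card (common_nbrs (mate n) x y) = card (common_nbrs (johnson_graph {2} n 4) u v)"
    if xy: "(x, y) \<in> parcs (mate n)"
      and uv: "u \<subseteq> {1..n}" "card u = 4" "v \<subseteq> {1..n}" "card v = 4" "card (u \<inter> v) = 2"
    for x y u v
  proof -
    obtain x' y' where xy': "(x', y') \<in> parcs (johnson_graph {2} n 4)"
      "card (common_nbrs (johnson_graph {2} n 4) x' y') = card (common_nbrs (mate n) x y)"
      using card_common_nbrs_iso[OF J pair_graph_mate iso xy] .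
    moreover have "card (common_nbrs (johnson_graph {2} n 4) x' y') =
        card (common_nbrs (johnson_graph {2} n 4) u v)"
      by (rule card_common_nbrs_johnson_graph) (use uv xy' in \<open>auto simp: johnson_graph_def\<close>)
    ultimately show ?thesis
      by simp
  qed
  show False
  proof (cases "n = 8")
    case True
    have "mate_adj {1, 4, 5, 6} {1, 2, 7, 8}"
      by code_simp
    then have "({1, 4, 5, 6}, {1, 2, 7, 8}) \<in> parcs (mate n)"
      using n by (simp add: mate_def)
    from const[OF this, of "{1, 2, 3, 4}" "{1, 2, 5, 6}"] show False
      using n card_common_nbrs_8 by (simp add: True)
  next
    case False
    have "mate_adj {1, 2, 3, 5} {1, 2, 4, 7}"
      by code_simp
    then have "({1, 2, 3, 5}, {1, 2, 4, 7}) \<in> parcs (mate n)"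
      using n by (simp add: mate_def)
    \<comment> \<open>This pair is an edge of both graphs and is compared with itself.\<close>
    from const[OF this, of "{1, 2, 3, 5}" "{1, 2, 4, 7}"] show False
      using n False card_common_nbrs_mate_less[of n] by simp
  qed
qed

theorem theorem4p2:
  fixes n :: nat
  assumes "n \<ge> 8"
  shows "\<not> determined_by_spectrum (johnson_graph {2} n 4)"
proof
  assume "determined_by_spectrum (johnson_graph {2} n 4)"
  then have "digraph_iso (mate n) (johnson_graph {2} n 4)"
    using pair_graph_mate cospectral_johnson_graph_mate assms
    by (intro determined_by_spectrumD) simp_all
  then show False
    using not_digraph_iso_mate[OF assms] by simp
qed

end
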